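(* Let $W$ be a non-negative, integer-valued random variable such that $\mathbb{E}[W]=\lambda>0$ and $W+1\geq_{st}W^\star$, where $W^\star$ has the $W$-size-biased distribution. Let $Z_\lambda\sim\mathrm{Po}(\lambda)$ and let $X_1,X_2,\ldots$ be iid non-negative, integer-valued random variables (independent of $W$ and of $Z_\lambda$). Let $$\widehat{W}=\sum_{i=1}^WX_i,\qquad \widehat{Z_\lambda}=\sum_{i=1}^{Z_\lambda}X_i.$$ If $\widehat{Z_\lambda}$ is log-concave, then $H(\widehat{W})\leq H(\widehat{Z_\lambda})$.
   Context: $\mathrm{Po}(\lambda)$ is the Poisson distribution with mean $\lambda$. $W^\star$ has mass function $\mathbb{P}(W^\star=j)=j\,\mathbb{P}(W=j)/\lambda$, $j\in\{0,1,2,\ldots\}$. $\geq_{st}$ denotes the usual stochastic order. The entropy of a non-negative integer-valued random variable $X$ is $H(X)=-\sum_{i=0}^\infty\mathbb{P}(X=i)\log\mathbb{P}(X=i)$ (natural logarithm, $0\log0=0$). A non-negative integer-valued random variable $X$ is log-concave if its support is an interval in $\{0,1,2,\ldots\}$ and $\mathbb{P}(X=i)^2\geq\mathbb{P}(X=i-1)\mathbb{P}(X=i+1)$ for all integers $i\geq1$. *)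

theory Defs
  imports "HOL-Probability.Probability"
begin

text \<open>Random variables are measurable maps into \<^term>\<open>count_space (UNIV :: nat set)\<close> on some
  probability space; properties of distributions take the underlying space as an argument, so
  that variables living on different spaces can be compared.\<close>

text \<open>\<open>size_biased M W N Ws\<close>: the variable \<open>Ws\<close> on \<open>N\<close> has the \<open>W\<close>-size-biased distribution.\<close>

definition size_biased :: "'a measure \<Rightarrow> ('a \<Rightarrow> nat) \<Rightarrow> 'b measure \<Rightarrow> ('b \<Rightarrow> nat) \<Rightarrow> bool" where
  "size_biased M W N Ws \<longleftrightarrow>
     (\<forall>j. \<P>(\<omega> in N. Ws \<omega> = j)
          = real j * \<P>(\<omega> in M. W \<omega> = j) / integral\<^sup>L M (\<lambda>\<omega>. real (W \<omega>)))"

text \<open>\<open>stoch_ge M X N Y\<close>: \<open>X \<ge>\<^sub>s\<^sub>t Y\<close> in the usual stochastic order.\<close>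

definition stoch_ge :: "'a measure \<Rightarrow> ('a \<Rightarrow> nat) \<Rightarrow> 'b measure \<Rightarrow> ('b \<Rightarrow> nat) \<Rightarrow> bool" where
  "stoch_ge M X N Y \<longleftrightarrow> (\<forall>t. \<P>(\<omega> in M. X \<omega> > t) \<ge> \<P>(\<omega> in N. Y \<omega> > t))"

text \<open>The terms of the entropy series are non-negative, so its value always exists in
  \<open>[0, \<infinity>]\<close>. Since \<^prop>\<open>ln (0::real) = 0\<close>, the convention \<open>0 log 0 = 0\<close> is built in.\<close>

definition shannon_entropy :: "'a measure \<Rightarrow> ('a \<Rightarrow> nat) \<Rightarrow> ennreal" where
  "shannon_entropy M X =
     (\<Sum>i. ennreal (- (\<P>(\<omega> in M. X \<omega> = i) * ln (\<P>(\<omega> in M. X \<omega> = i)))))"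

definition rv_support :: "'a measure \<Rightarrow> ('a \<Rightarrow> nat) \<Rightarrow> nat set" where
  "rv_support M X = {i. \<P>(\<omega> in M. X \<omega> = i) > 0}"

definition log_concave_rv :: "'a measure \<Rightarrow> ('a \<Rightarrow> nat) \<Rightarrow> bool" where
  "log_concave_rv M X \<longleftrightarrow>
     (\<forall>a\<in>rv_support M X. \<forall>b\<in>rv_support M X. {a..b} \<subseteq> rv_support M X) \<and>
     (\<forall>i\<ge>1. (\<P>(\<omega> in M. X \<omega> = i))\<^sup>2
              \<ge> \<P>(\<omega> in M. X \<omega> = i - 1) * \<P>(\<omega> in M. X \<omega> = i + 1))"

text \<open>Sequences \<open>X\<^sub>1, X\<^sub>2, \<dots>\<close> are functions on \<^typ>\<open>nat\<close> whose value at 0 is never used.\<close>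

definition random_sum :: "('a \<Rightarrow> nat) \<Rightarrow> (nat \<Rightarrow> 'a \<Rightarrow> nat) \<Rightarrow> 'a \<Rightarrow> nat" where
  "random_sum V X \<omega> = (\<Sum>i = 1..V \<omega>. X i \<omega>)"

definition iid_seq :: "'a measure \<Rightarrow> (nat \<Rightarrow> 'a \<Rightarrow> nat) \<Rightarrow> bool" where
  "iid_seq M X \<longleftrightarrow>
     prob_space.indep_vars M (\<lambda>_. count_space UNIV) X {1..} \<and>
     (\<forall>i\<ge>1. distr M (count_space UNIV) (X i) = distr M (count_space UNIV) (X 1))"

text \<open>Independence of \<open>V\<close> from the whole sequence \<open>(X\<^sub>1, X\<^sub>2, \<dots>)\<close>, not just from each \<open>X\<^sub>i\<close>:
  the generated sigma-algebras are independent. (\<^const>\<open>prob_space.indep_var\<close> requires both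
  variables to have the same type, so it does not apply here.)\<close>

definition indep_of_seq :: "'a measure \<Rightarrow> ('a \<Rightarrow> nat) \<Rightarrow> (nat \<Rightarrow> 'a \<Rightarrow> nat) \<Rightarrow> bool" where
  "indep_of_seq M V X \<longleftrightarrow>
     prob_space.indep_set M
       {V -` A \<inter> space M | A. A \<in> sets (count_space (UNIV :: nat set))}
       {(\<lambda>\<omega>. \<lambda>i\<in>{1..}. X i \<omega>) -` B \<inter> space M | B.
          B \<in> sets (Pi\<^sub>M {1..} (\<lambda>_. count_space (UNIV :: nat set)))}"

end

theory Submission imports Defs begin

text \<open>Write \<open>p\<close> for the law of the compound Poisson sum and \<open>f = - ln p\<close>. Gibbs' inequality bounds
the entropy of the compound \<open>W\<close>-sum by its cross-entropy against \<open>p\<close>, which is the expectation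
of \<open>f\<close> at that sum; at the compound Poisson sum the same expectation is the entropy of the Poisson
side. It therefore suffices that expectations of \<open>f\<close> increase when the number of summands changes
from \<open>W\<close> to \<open>Z\<close>, and log-concavity enters because it says that \<open>f\<close> is convex.

Convexity passes from \<open>f\<close> to the function \<open>n \<mapsto> E f(X\<^sub>1 + \<dots> + X\<^sub>n)\<close> of the number of summands:
\<open>f (s + x + y) + f s \<ge> f (s + x) + f (s + y)\<close> for a convex \<open>f\<close> and \<open>x, y \<ge> 0\<close>, and replacing
\<open>X\<^sub>n\<^sub>+\<^sub>1\<close> by \<open>X\<^sub>n\<^sub>+\<^sub>2\<close> does not change the law of a sum (\<open>partial_sum_expectation_convex\<close>).
What is left is that \<open>W\<close> is below \<open>Z\<close> in the convex order, and for variables of equal mean this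
order is tested on the hinge functions \<open>n \<mapsto> max (n - t) 0\<close>: a convex function on the natural
numbers is an affine function plus a non-negative combination of hinges (\<open>hinge_expansion\<close>).

The comparison of the stop-loss transforms \<open>a t = E max (W - t) 0\<close> and \<open>b t = E max (Z - t) 0\<close> is
where size biasing is used (\<open>stop_loss_le\<close>). Both \<open>E[W; W > t] = l * P(Ws > t)\<close> and \<open>P(W > t)\<close> are
expressions in \<open>a\<close>, so the stochastic domination becomes a second-order difference inequality for
\<open>a\<close>; the Poisson law satisfies it with equality, because \<open>Z + 1\<close> has the size-biased law of
\<open>Z\<close>. The difference \<open>b - a\<close> thus satisfies a difference inequality that excludes a negative
minimum at a positive argument, while it vanishes at 0 and at infinity, so it is non-negative.

The logarithm of \<open>p\<close> makes sense everywhere only if \<open>p\<close> has no zeros. As the support of \<open>p\<close> is an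
interval, this can fail only if the summands vanish almost surely, and then both entropies are 0.\<close>

section \<open>Stop-loss transforms and size biasing\<close>

text \<open>A discrete minimum principle: at a negative minimum, which would lie at some positive argument, the
left-hand side of the difference inequality is non-negative and the right-hand side negative.
The limit condition guarantees that the infimum of \<open>d\<close> is attained if it is negative.\<close>

lemma minimum_principle:
  fixes d :: "nat \<Rightarrow> real"
  assumes "l \<ge> 0" and "d 0 = 0" and "d \<longlonglongrightarrow> 0"
    and super: "\<And>t. l * (d t - d (Suc t)) \<le> d (Suc t) + real (Suc t) * (d (Suc t) - d (Suc (Suc t)))"
  shows "d n \<ge> 0"
proof (rule ccontr)
  assume "\<not> d n \<ge> 0"
  then have neg: "d n < 0" by simp
  then have "eventually (\<lambda>k. d n < d k) sequentially"
    using order_tendstoD(1)[OF \<open>d \<longlonglongrightarrow> 0\<close>] by blast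
  \<comment> \<open>Beyond \<open>K\<close> all values exceed \<open>d n\<close>, so a minimum over the finite range up to \<open>max n K\<close> is global.\<close>
  then obtain K where K: "\<And>k. k \<ge> K \<Longrightarrow> d n < d k"
    by (auto simp: eventually_sequentially)
  define m where "m = (ARG_MIN d k. k \<in> {..max n K})"
  have min: "d m \<le> d k" if "k \<le> max n K" for k
    unfolding m_def using arg_min_least[of "{..max n K}" k d] that by (auto simp: arg_min_on_def)
  have min: "d m \<le> d k" for k
    using min[of k] min[of n] K[of k] by (cases "k \<le> max n K") force+
  have "d m < 0" using min[of n] neg by simp
  then obtain t where t: "m = Suc t" using \<open>d 0 = 0\<close> by (cases m) auto
  have "0 \<le> l * (d t - d m)" using min[of t] \<open>l \<ge> 0\<close> by simp
  moreover have "real m * (d m - d (Suc m)) \<le> 0"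
    using min[of "Suc m"] by (simp add: mult_nonneg_nonpos)
  ultimately show False using super[of t] \<open>d m < 0\<close> unfolding t by linarith
qed

lemma nn_integral_nat_valued:
  fixes h :: "nat \<Rightarrow> ennreal"
  assumes [measurable]: "V \<in> measurable M (count_space UNIV)"
  shows "(\<integral>\<^sup>+ \<omega>. h (V \<omega>) \<partial>M) = (\<Sum>j. h j * emeasure M {\<omega> \<in> space M. V \<omega> = j})"
proof -
  have "h (V \<omega>) = (\<Sum>j. h j * indicator {\<omega> \<in> space M. V \<omega> = j} \<omega>)" if "\<omega> \<in> space M" for \<omega>
    using that by (subst suminf_finite[of "{V \<omega>}"]) (auto simp: indicator_def)
  then have "(\<integral>\<^sup>+ \<omega>. h (V \<omega>) \<partial>M)
      = (\<integral>\<^sup>+ \<omega>. (\<Sum>j. h j * indicator {\<omega> \<in> space M. V \<omega> = j} \<omega>) \<partial>M)"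
    by (intro nn_integral_cong) auto
  also have "\<dots> = (\<Sum>j. h j * emeasure M {\<omega> \<in> space M. V \<omega> = j})"
    by (subst nn_integral_suminf) (auto simp: nn_integral_cmult_indicator)
  finally show ?thesis .
qed

text \<open>Both sides equal \<open>E[V; V > t]\<close>: the left one by the definition of the size-biased law, the right
one because \<open>V = max (V - t) 0 + t\<close> on the event \<open>V > t\<close>. This rewrites tails of the size-biased
variable in terms of the stop-loss transform of \<open>V\<close>.\<close>

lemma (in prob_space) size_biased_tail:
  fixes V :: "'a \<Rightarrow> nat" and Vs :: "'b \<Rightarrow> nat"
  assumes "prob_space N"
    and V[measurable]: "V \<in> measurable M (count_space UNIV)"
    and int: "integrable M (\<lambda>\<omega>. real (V \<omega>))"
    and l: "expectation (\<lambda>\<omega>. real (V \<omega>)) = l" "l > 0"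
    and Vs[measurable]: "Vs \<in> measurable N (count_space UNIV)"
    and sb: "size_biased M V N Vs"
  shows "l * \<P>(\<omega> in N. Vs \<omega> > t)
    = expectation (\<lambda>\<omega>. real (V \<omega> - t)) + real t * prob {\<omega> \<in> space M. V \<omega> > t}"
proof -
  interpret N: prob_space N by fact
  let ?A = "{\<omega> \<in> space M. V \<omega> > t}"
  have i1: "integrable M (\<lambda>\<omega>. real (V \<omega> - t))"
    by (rule Bochner_Integration.integrable_bound[OF int]) auto
  have i2: "integrable M (\<lambda>\<omega>. real t * indicator ?A \<omega>)"
    by (intro integrable_mult_right integrable_real_indicator) (auto simp: emeasure_eq_measure)
  define h :: "nat \<Rightarrow> ennreal" where "h j = (if j > t then 1 else 0)" for j
  have "ennreal (l * \<P>(\<omega> in N. Vs \<omega> > t)) = ennreal l * (\<integral>\<^sup>+ \<omega>. h (Vs \<omega>) \<partial>N)"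
  proof -
    have "(\<integral>\<^sup>+ \<omega>. h (Vs \<omega>) \<partial>N) = (\<integral>\<^sup>+ \<omega>. indicator {\<omega> \<in> space N. Vs \<omega> > t} \<omega> \<partial>N)"
      by (intro nn_integral_cong) (auto simp: h_def)
    then show ?thesis using l by (simp add: N.emeasure_eq_measure ennreal_mult)
  qed
  also have "\<dots> = (\<Sum>j. ennreal l * (h j * emeasure N {\<omega> \<in> space N. Vs \<omega> = j}))"
    by (simp add: nn_integral_nat_valued[OF Vs] ennreal_suminf_cmult)
  also have "\<dots> = (\<Sum>j. (h j * ennreal j) * emeasure M {\<omega> \<in> space M. V \<omega> = j})"
  proof (intro suminf_cong)
    fix j
    have "l * \<P>(\<omega> in N. Vs \<omega> = j) = real j * \<P>(\<omega> in M. V \<omega> = j)"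
      using sb l by (simp add: size_biased_def)
    then have "ennreal l * emeasure N {\<omega> \<in> space N. Vs \<omega> = j}
        = ennreal j * emeasure M {\<omega> \<in> space M. V \<omega> = j}"
      using l(2) by (simp add: N.emeasure_eq_measure emeasure_eq_measure flip: ennreal_mult)
    then show "ennreal l * (h j * emeasure N {\<omega> \<in> space N. Vs \<omega> = j})
        = (h j * ennreal j) * emeasure M {\<omega> \<in> space M. V \<omega> = j}"
      by (simp only: mult.assoc mult.left_commute[of "ennreal l" "h j"])
  qed
  also have "\<dots> = (\<integral>\<^sup>+ \<omega>. h (V \<omega>) * ennreal (V \<omega>) \<partial>M)"
    by (rule nn_integral_nat_valued[OF V, symmetric])
  also have "\<dots> = (\<integral>\<^sup>+ \<omega>. ennreal (real (V \<omega> - t) + real t * indicator ?A \<omega>) \<partial>M)"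
    by (intro nn_integral_cong) (auto simp: h_def of_nat_diff simp flip: ennreal_plus split: split_indicator)
  also have "\<dots> = ennreal (expectation (\<lambda>\<omega>. real (V \<omega> - t) + real t * indicator ?A \<omega>))"
    by (intro nn_integral_eq_integral Bochner_Integration.integrable_add i1 i2) auto
  also have "expectation (\<lambda>\<omega>. real (V \<omega> - t) + real t * indicator ?A \<omega>)
      = expectation (\<lambda>\<omega>. real (V \<omega> - t)) + real t * prob ?A"
    by (subst Bochner_Integration.integral_add[OF i1 i2]) simp
  finally show ?thesis using l by (subst (asm) ennreal_inj) auto
qed

lemma (in prob_space) stop_loss_diff:
  fixes V :: "'a \<Rightarrow> nat"
  assumes [measurable]: "V \<in> measurable M (count_space UNIV)"
    and int: "integrable M (\<lambda>\<omega>. real (V \<omega>))"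
  shows "prob {\<omega> \<in> space M. V \<omega> > t}
    = expectation (\<lambda>\<omega>. real (V \<omega> - t)) - expectation (\<lambda>\<omega>. real (V \<omega> - Suc t))"
proof -
  have i: "integrable M (\<lambda>\<omega>. real (V \<omega> - s))" for s
    by (rule Bochner_Integration.integrable_bound[OF int]) auto
  have "expectation (\<lambda>\<omega>. real (V \<omega> - t)) - expectation (\<lambda>\<omega>. real (V \<omega> - Suc t))
      = expectation (\<lambda>\<omega>. real (V \<omega> - t) - real (V \<omega> - Suc t))"
    using i by simp
  also have "\<dots> = expectation (indicator {\<omega> \<in> space M. V \<omega> > t})"
    by (intro Bochner_Integration.integral_cong) (auto split: split_indicator)
  finally show ?thesis by simp
qed

lemma (in prob_space) stop_loss_tendsto_0:
  fixes V :: "'a \<Rightarrow> nat"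
  assumes [measurable]: "V \<in> measurable M (count_space UNIV)"
    and int: "integrable M (\<lambda>\<omega>. real (V \<omega>))"
  shows "(\<lambda>t. expectation (\<lambda>\<omega>. real (V \<omega> - t))) \<longlonglongrightarrow> 0"
proof -
  have "(\<lambda>t. expectation (\<lambda>\<omega>. real (V \<omega> - t))) \<longlonglongrightarrow> expectation (\<lambda>\<omega>. 0)"
  proof (rule integral_dominated_convergence[OF _ _ int])
    have "(\<lambda>t. real (n - t)) \<longlonglongrightarrow> 0" for n :: nat
      by (rule tendsto_eventually) (auto simp: eventually_sequentially intro!: exI[of _ n])
    then show "AE \<omega> in M. (\<lambda>t. real (V \<omega> - t)) \<longlonglongrightarrow> 0" by auto
  qed auto
  then show ?thesis by simp
qed

text \<open>In terms of the stop-loss transform \<open>a\<close> of \<open>V\<close>, the stochastic domination at the argument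
\<open>t + 1\<close> reads \<open>a (t+1) + (t+1) (a (t+1) - a (t+2)) \<le> l (a t - a (t+1))\<close>. The hypothesis on \<open>Z\<close>,
which characterises the Poisson law of mean \<open>l\<close>, gives equality for \<open>Z\<close>. Subtracting the two
yields the difference inequality of the minimum principle.\<close>

lemma (in prob_space) stop_loss_le:
  fixes V Z :: "'a \<Rightarrow> nat" and Vs :: "'b \<Rightarrow> nat"
  assumes N: "prob_space N" and "l > 0"
    and V[measurable]: "V \<in> measurable M (count_space UNIV)"
    and iV: "integrable M (\<lambda>\<omega>. real (V \<omega>))" and lV: "expectation (\<lambda>\<omega>. real (V \<omega>)) = l"
    and Vs: "Vs \<in> measurable N (count_space UNIV)"
    and sb: "size_biased M V N Vs" and st: "stoch_ge M (\<lambda>\<omega>. V \<omega> + 1) N Vs"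
    and Z[measurable]: "Z \<in> measurable M (count_space UNIV)"
    and iZ: "integrable M (\<lambda>\<omega>. real (Z \<omega>))" and lZ: "expectation (\<lambda>\<omega>. real (Z \<omega>)) = l"
    and sbZ: "size_biased M Z M (\<lambda>\<omega>. Z \<omega> + 1)"
  shows "expectation (\<lambda>\<omega>. real (V \<omega> - t)) \<le> expectation (\<lambda>\<omega>. real (Z \<omega> - t))"
proof -
  define a where "a t = expectation (\<lambda>\<omega>. real (V \<omega> - t))" for t
  define b where "b t = expectation (\<lambda>\<omega>. real (Z \<omega> - t))" for t
  have "0 \<le> b t - a t"
  proof (rule minimum_principle[of l "\<lambda>t. b t - a t"])
    show "(\<lambda>t. b t - a t) \<longlonglongrightarrow> 0"
      using tendsto_diff[OF stop_loss_tendsto_0[OF Z iZ] stop_loss_tendsto_0[OF V iV]]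
      by (simp add: a_def b_def)
  next
    fix t
    have dV: "prob {\<omega> \<in> space M. V \<omega> > t} = a t - a (Suc t)" for t
      unfolding a_def by (rule stop_loss_diff[OF V iV])
    have dZ: "prob {\<omega> \<in> space M. Z \<omega> > t} = b t - b (Suc t)" for t
      unfolding b_def by (rule stop_loss_diff[OF Z iZ])
    have "a (Suc t) + real (Suc t) * (a (Suc t) - a (Suc (Suc t)))
        = l * \<P>(\<omega> in N. Vs \<omega> > Suc t)"
      using size_biased_tail[OF N V iV lV \<open>l > 0\<close> Vs sb, of "Suc t"]
      unfolding dV a_def[of "Suc t", symmetric] by simp
    also have "\<dots> \<le> l * \<P>(\<omega> in M. V \<omega> + 1 > Suc t)"
      using st \<open>l > 0\<close> unfolding stoch_ge_def by (intro mult_left_mono) (simp_all only: less_imp_le)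
    also have "\<dots> = l * (a t - a (Suc t))" using dV[of t] by simp
    finally have ineqV: "a (Suc t) + real (Suc t) * (a (Suc t) - a (Suc (Suc t)))
        \<le> l * (a t - a (Suc t))" .
    have "b (Suc t) + real (Suc t) * (b (Suc t) - b (Suc (Suc t)))
        = l * \<P>(\<omega> in M. Z \<omega> + 1 > Suc t)"
      using size_biased_tail[OF prob_space_axioms Z iZ lZ \<open>l > 0\<close> _ sbZ, of "Suc t"]
      unfolding dZ b_def[of "Suc t", symmetric] by simp
    also have "\<dots> = l * (b t - b (Suc t))" using dZ[of t] by simp
    finally show "l * ((b t - a t) - (b (Suc t) - a (Suc t)))
      \<le> (b (Suc t) - a (Suc t)) + real (Suc t)
          * ((b (Suc t) - a (Suc t)) - (b (Suc (Suc t)) - a (Suc (Suc t))))"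
      using ineqV by (simp add: algebra_simps)
  qed (use \<open>l > 0\<close> lV lZ in \<open>auto simp: a_def b_def\<close>)
  then show ?thesis by (simp add: a_def b_def)
qed

text \<open>All four facts come from the recursion \<open>(j + 1) P(Z = j + 1) = l P(Z = j)\<close> of the Poisson weights.\<close>

lemma (in prob_space) poisson_size_biased:
  fixes Z :: "'a \<Rightarrow> nat"
  assumes "l > 0" and Z[measurable]: "Z \<in> measurable M (count_space UNIV)"
    and d: "distr M (count_space UNIV) Z = measure_pmf (poisson_pmf l)"
  shows "prob {\<omega> \<in> space M. Z \<omega> = j} = l ^ j / fact j * exp (- l)"
    and "integrable M (\<lambda>\<omega>. real (Z \<omega>))"
    and "expectation (\<lambda>\<omega>. real (Z \<omega>)) = l"
    and "size_biased M Z M (\<lambda>\<omega>. Z \<omega> + 1)"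
proof -
  have p: "prob {\<omega> \<in> space M. Z \<omega> = j} = l ^ j / fact j * exp (- l)" for j
  proof -
    have "prob {\<omega> \<in> space M. Z \<omega> = j} = measure (distr M (count_space UNIV) Z) {j}"
      by (subst measure_distr) (auto intro!: arg_cong[where f=prob])
    also have "\<dots> = pmf (poisson_pmf l) j" by (simp add: d measure_pmf_single)
    finally show ?thesis using \<open>l > 0\<close> by simp
  qed
  show "prob {\<omega> \<in> space M. Z \<omega> = j} = l ^ j / fact j * exp (- l)" by (rule p)
  have shift: "real (Suc j) * prob {\<omega> \<in> space M. Z \<omega> = Suc j} = l * prob {\<omega> \<in> space M. Z \<omega> = j}" for j
  proof -
    have "real (Suc j) / fact (Suc j) = 1 / fact j" by simp
    then have "l * l ^ j * exp (- l) * (real (Suc j) / fact (Suc j)) = l * l ^ j * exp (- l) * (1 / fact j)"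
      by (simp only:)
    then show ?thesis unfolding p by (simp only: power_Suc times_divide_eq_right times_divide_eq_left mult_ac mult_1_left)
  qed
  have "(\<integral>\<^sup>+ \<omega>. ennreal (real (Z \<omega>)) \<partial>M)
      = (\<Sum>j. ennreal (real j) * emeasure M {\<omega> \<in> space M. Z \<omega> = j})"
    by (rule nn_integral_nat_valued[OF Z])
  also have "\<dots> = (\<Sum>j. ennreal (real (Suc j)) * emeasure M {\<omega> \<in> space M. Z \<omega> = Suc j})"
    by (subst suminf_offset[where i=1]) auto
  also have "\<dots> = (\<Sum>j. ennreal l * emeasure M {\<omega> \<in> space M. Z \<omega> = j})"
  proof (rule suminf_cong)
    show "ennreal (real (Suc j)) * emeasure M {\<omega> \<in> space M. Z \<omega> = Suc j}
        = ennreal l * emeasure M {\<omega> \<in> space M. Z \<omega> = j}" for j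
      unfolding emeasure_eq_measure using \<open>l > 0\<close>
      by (subst (1 2) ennreal_mult[symmetric]) (simp_all only: shift of_nat_0_le_iff measure_nonneg less_imp_le)
  qed
  also have "\<dots> = ennreal l * (\<integral>\<^sup>+ \<omega>. 1 \<partial>M)"
    unfolding nn_integral_nat_valued[OF Z, of "\<lambda>_. 1"] ennreal_suminf_cmult mult_1 ..
  finally have nn: "(\<integral>\<^sup>+ \<omega>. ennreal (real (Z \<omega>)) \<partial>M) = ennreal l"
    by (simp add: emeasure_space_1)
  then show "integrable M (\<lambda>\<omega>. real (Z \<omega>))"
    by (intro integrableI_nonneg) auto
  show mean: "expectation (\<lambda>\<omega>. real (Z \<omega>)) = l"
    using \<open>l > 0\<close> by (subst integral_eq_nn_integral) (simp_all add: nn)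
  have "prob {\<omega> \<in> space M. Z \<omega> + 1 = j} = real j * prob {\<omega> \<in> space M. Z \<omega> = j} / l" for j
    using shift[of "j - 1"] \<open>l > 0\<close> by (cases j) auto
  then show "size_biased M Z M (\<lambda>\<omega>. Z \<omega> + 1)"
    unfolding size_biased_def mean by simp
qed

section \<open>Convex order\<close>

text \<open>Discrete Taylor expansion of second order at 0; the coefficients of the hinge functions are the
second differences of \<open>g\<close>.\<close>

lemma hinge_expansion:
  fixes g :: "nat \<Rightarrow> real"
  shows "g n = g 0 + real n * (g 1 - g 0)
    + (\<Sum>k<n. (g (k + 2) - 2 * g (k + 1) + g k) * real (n - Suc k))"
proof (induction n)
  case (Suc n)
  let ?D = "\<lambda>k. g (k + 2) - 2 * g (k + 1) + g k"
  \<comment> \<open>Each hinge with \<open>k < n\<close> grows by 1 from \<open>n\<close> to \<open>n + 1\<close>, so the sum grows by the slope of \<open>g\<close> at \<open>n\<close>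
    beyond its initial slope.\<close>
  have slope: "(\<Sum>k<n. ?D k) = g (Suc n) - g n - (g 1 - g 0)"
    by (induction n) (auto simp: algebra_simps)
  have "(\<Sum>k<Suc n. ?D k * real (Suc n - Suc k)) = (\<Sum>k<n. ?D k * real (n - Suc k) + ?D k)"
    by (simp, intro sum.cong) (auto simp: algebra_simps of_nat_diff)
  also have "\<dots> = (\<Sum>k<n. ?D k * real (n - Suc k)) + (g (Suc n) - g n - (g 1 - g 0))"
    using sum.distrib[of "\<lambda>k. ?D k * real (n - Suc k)" ?D "{..<n}"] unfolding slope .
  finally show ?case using Suc by (simp add: algebra_simps)
qed simp

text \<open>The initial slope \<open>g 1 - g 0\<close> may be negative. Moving \<open>g 0 * E V\<close> to the other side leaves only
non-negative terms, so that the identity makes sense in \<open>[0, \<infinity>]\<close> even when \<open>E g(V)\<close> is infinite.\<close>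

lemma (in prob_space) nn_integral_hinge:
  fixes g :: "nat \<Rightarrow> real" and V :: "'a \<Rightarrow> nat"
  assumes [measurable]: "V \<in> measurable M (count_space UNIV)"
    and int: "integrable M (\<lambda>\<omega>. real (V \<omega>))"
    and nonneg: "\<And>n. g n \<ge> 0" and conv: "\<And>n. 2 * g (n + 1) \<le> g n + g (n + 2)"
  shows "(\<integral>\<^sup>+ \<omega>. ennreal (g (V \<omega>)) \<partial>M) + ennreal (g 0 * expectation (\<lambda>\<omega>. real (V \<omega>)))
    = ennreal (g 0) + ennreal (g 1 * expectation (\<lambda>\<omega>. real (V \<omega>)))
      + (\<Sum>k. ennreal (g (k + 2) - 2 * g (k + 1) + g k)
              * ennreal (expectation (\<lambda>\<omega>. real (V \<omega> - Suc k))))"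
proof -
  let ?D = "\<lambda>k. g (k + 2) - 2 * g (k + 1) + g k"
  have D: "?D k \<ge> 0" for k using conv[of k] by simp
  have i: "integrable M (\<lambda>\<omega>. real (V \<omega> - s))" for s
    by (rule Bochner_Integration.integrable_bound[OF int]) auto
  have E: "(\<integral>\<^sup>+ \<omega>. ennreal (real (V \<omega> - s)) \<partial>M) = ennreal (expectation (\<lambda>\<omega>. real (V \<omega> - s)))" for s
    by (intro nn_integral_eq_integral i) auto
  have E0: "(\<integral>\<^sup>+ \<omega>. ennreal (real (V \<omega>)) \<partial>M) = ennreal (expectation (\<lambda>\<omega>. real (V \<omega>)))"
    using E[of 0] by simp
  have c: "(\<integral>\<^sup>+ \<omega>. ennreal (c * real (V \<omega>)) \<partial>M) = ennreal (c * expectation (\<lambda>\<omega>. real (V \<omega>)))"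
    if "c \<ge> 0" for c
    using that by (simp add: ennreal_mult' nn_integral_cmult E0)
  have pt: "ennreal (g n) + ennreal (g 0 * real n)
    = ennreal (g 0) + ennreal (g 1 * real n) + (\<Sum>k. ennreal (?D k) * ennreal (real (n - Suc k)))" for n
  proof -
    have "(\<Sum>k. ennreal (?D k) * ennreal (real (n - Suc k)))
        = (\<Sum>k<n. ennreal (?D k) * ennreal (real (n - Suc k)))"
      by (rule suminf_finite) auto
    also have "\<dots> = ennreal (\<Sum>k<n. ?D k * real (n - Suc k))"
      using D by (subst sum_ennreal[symmetric]) (auto simp: ennreal_mult)
    finally have s: "(\<Sum>k. ennreal (?D k) * ennreal (real (n - Suc k)))
        = ennreal (\<Sum>k<n. ?D k * real (n - Suc k))" .
    have "0 \<le> (\<Sum>k<n. ?D k * real (n - Suc k))" using D by (intro sum_nonneg) auto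
    then show ?thesis
      unfolding s using hinge_expansion[of g n] nonneg
      by (simp add: algebra_simps flip: ennreal_plus)
  qed
  have "(\<integral>\<^sup>+ \<omega>. ennreal (g (V \<omega>)) \<partial>M) + ennreal (g 0 * expectation (\<lambda>\<omega>. real (V \<omega>)))
    = (\<integral>\<^sup>+ \<omega>. ennreal (g (V \<omega>)) + ennreal (g 0 * real (V \<omega>)) \<partial>M)"
    using nonneg by (subst nn_integral_add) (auto simp: c)
  also have "\<dots> = (\<integral>\<^sup>+ \<omega>. ennreal (g 0) + ennreal (g 1 * real (V \<omega>))
      + (\<Sum>k. ennreal (?D k) * ennreal (real (V \<omega> - Suc k))) \<partial>M)"
    by (simp only: pt)
  also have "\<dots> = ennreal (g 0) + ennreal (g 1 * expectation (\<lambda>\<omega>. real (V \<omega>)))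
      + (\<integral>\<^sup>+ \<omega>. (\<Sum>k. ennreal (?D k) * ennreal (real (V \<omega> - Suc k))) \<partial>M)"
    using nonneg by (subst nn_integral_add, simp, simp, subst nn_integral_add) (auto simp: c emeasure_space_1)
  also have "(\<integral>\<^sup>+ \<omega>. (\<Sum>k. ennreal (?D k) * ennreal (real (V \<omega> - Suc k))) \<partial>M)
      = (\<Sum>k. ennreal (?D k) * ennreal (expectation (\<lambda>\<omega>. real (V \<omega> - Suc k))))"
    by (subst nn_integral_suminf) (simp_all add: nn_integral_cmult E)
  finally show ?thesis .
qed

lemma (in prob_space) stop_loss_order_imp_convex_order:
  fixes g :: "nat \<Rightarrow> real" and V Z :: "'a \<Rightarrow> nat"
  assumes V: "V \<in> measurable M (count_space UNIV)" "integrable M (\<lambda>\<omega>. real (V \<omega>))"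
    and Z: "Z \<in> measurable M (count_space UNIV)" "integrable M (\<lambda>\<omega>. real (Z \<omega>))"
    and mean: "expectation (\<lambda>\<omega>. real (V \<omega>)) = expectation (\<lambda>\<omega>. real (Z \<omega>))"
    and sl: "\<And>t. expectation (\<lambda>\<omega>. real (V \<omega> - t)) \<le> expectation (\<lambda>\<omega>. real (Z \<omega> - t))"
    and g: "\<And>n. g n \<ge> 0" "\<And>n. 2 * g (n + 1) \<le> g n + g (n + 2)"
  shows "(\<integral>\<^sup>+ \<omega>. ennreal (g (V \<omega>)) \<partial>M) \<le> (\<integral>\<^sup>+ \<omega>. ennreal (g (Z \<omega>)) \<partial>M)"
proof -
  let ?c = "ennreal (g 0 * expectation (\<lambda>\<omega>. real (Z \<omega>)))"
  have "(\<integral>\<^sup>+ \<omega>. ennreal (g (V \<omega>)) \<partial>M) + ?c \<le> (\<integral>\<^sup>+ \<omega>. ennreal (g (Z \<omega>)) \<partial>M) + ?c"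
    using nn_integral_hinge[OF V g] nn_integral_hinge[OF Z g] unfolding mean
    by (auto intro!: add_mono suminf_le mult_left_mono ennreal_leI sl)
  then show ?thesis by (simp add: ennreal_add_left_cancel_le add.commute[of _ ?c])
qed

lemma convex_four_point:
  fixes f :: "nat \<Rightarrow> real"
  assumes conv: "\<And>n. 2 * f (n + 1) \<le> f n + f (n + 2)"
  shows "f (x + a) + f (x + b) \<le> f x + f (x + a + b)"
proof (induction a)
  case (Suc a)
  have "mono (\<lambda>n. f (Suc n) - f n)"
    unfolding mono_iff_le_Suc using conv by (auto simp: algebra_simps)
  then have "f (Suc (x + a)) - f (x + a) \<le> f (Suc (x + a + b)) - f (x + a + b)"
    by (rule monoD) simp
  then show ?case using Suc by simp
qed simp

section \<open>Random sums\<close>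

lemma (in prob_space) iid_seqD:
  assumes "iid_seq M X"
  shows "indep_vars (\<lambda>_. count_space UNIV) X {1..}"
    and "i \<ge> 1 \<Longrightarrow> X i \<in> measurable M (count_space UNIV)"
    and "i \<ge> 1 \<Longrightarrow> distr M (count_space UNIV) (X i) = distr M (count_space UNIV) (X 1)"
    and "i \<ge> 1 \<Longrightarrow> prob {\<omega> \<in> space M. X i \<omega> = k} = prob {\<omega> \<in> space M. X 1 \<omega> = k}"
proof -
  show ind: "indep_vars (\<lambda>_. count_space UNIV) X {1..}"
    using assms unfolding iid_seq_def by (rule conjunct1)
  have X: "X i \<in> measurable M (count_space UNIV)" if "i \<ge> 1" for i
    using conjunct1[OF ind[unfolded indep_vars_def]] that by blast
  have dist: "distr M (count_space UNIV) (X i) = distr M (count_space UNIV) (X 1)" if "i \<ge> 1"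
    using assms that unfolding iid_seq_def by blast
  show "i \<ge> 1 \<Longrightarrow> X i \<in> measurable M (count_space UNIV)" by (rule X)
  show "i \<ge> 1 \<Longrightarrow> distr M (count_space UNIV) (X i) = distr M (count_space UNIV) (X 1)" by (rule dist)
  have pX: "prob {\<omega> \<in> space M. X i \<omega> = k} = measure (distr M (count_space UNIV) (X i)) {k}"
    if "i \<ge> 1" for i
    using X[OF that] by (subst measure_distr) (auto intro!: arg_cong[where f=prob])
  show "prob {\<omega> \<in> space M. X i \<omega> = k} = prob {\<omega> \<in> space M. X 1 \<omega> = k}" if "i \<ge> 1"
    unfolding pX[OF that] pX[OF order_refl] dist[OF that] ..
qed

lemma (in prob_space) nn_integral_indep_sum_cong:
  fixes U V V' :: "'a \<Rightarrow> nat" and f :: "nat \<Rightarrow> ennreal"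
  assumes i: "indep_var (count_space UNIV) U (count_space UNIV) V"
    and i': "indep_var (count_space UNIV) U (count_space UNIV) V'"
    and d: "distr M (count_space UNIV) V = distr M (count_space UNIV) V'"
  shows "(\<integral>\<^sup>+ \<omega>. f (U \<omega> + V \<omega>) \<partial>M) = (\<integral>\<^sup>+ \<omega>. f (U \<omega> + V' \<omega>) \<partial>M)"
proof -
  let ?P = "count_space UNIV \<Otimes>\<^sub>M count_space UNIV :: (nat \<times> nat) measure"
  have [measurable]: "U \<in> measurable M (count_space UNIV)" "V \<in> measurable M (count_space UNIV)"
    "V' \<in> measurable M (count_space UNIV)"
    using i i' by (auto dest: indep_var_rv1 indep_var_rv2)
  have "distr M ?P (\<lambda>\<omega>. (U \<omega>, V \<omega>)) = distr M ?P (\<lambda>\<omega>. (U \<omega>, V' \<omega>))"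
    using i i' d by (simp add: indep_var_distribution_eq)
  then have "(\<integral>\<^sup>+ z. f (fst z + snd z) \<partial>distr M ?P (\<lambda>\<omega>. (U \<omega>, V \<omega>)))
      = (\<integral>\<^sup>+ z. f (fst z + snd z) \<partial>distr M ?P (\<lambda>\<omega>. (U \<omega>, V' \<omega>)))"
    by simp
  then show ?thesis by (subst (asm) (1 2) nn_integral_distr) auto
qed

lemma (in prob_space) indep_partial_sum:
  fixes X :: "nat \<Rightarrow> 'a \<Rightarrow> nat"
  assumes "indep_vars (\<lambda>_. count_space UNIV) X {1..}" and "n < m"
  shows "indep_var (count_space UNIV) (\<lambda>\<omega>. \<Sum>i=1..n. X i \<omega>) (count_space UNIV) (X m)"
proof -
  have "indep_var (count_space UNIV)
      ((\<lambda>x. \<Sum>i=1..n. x i) \<circ> (\<lambda>\<omega>. restrict (\<lambda>i. X i \<omega>) {1..n}))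
      (count_space UNIV) ((\<lambda>x. x m) \<circ> (\<lambda>\<omega>. restrict (\<lambda>i. X i \<omega>) {m}))"
    using assms(2) by (intro indep_var_compose[OF indep_var_restrict[OF assms(1)]]) auto
  moreover have "(\<lambda>x. \<Sum>i=1..n. x i) \<circ> (\<lambda>\<omega>. restrict (\<lambda>i. X i \<omega>) {1..n})
      = (\<lambda>\<omega>. \<Sum>i=1..n. X i \<omega>)"
    by (auto simp: fun_eq_iff intro!: sum.cong)
  moreover have "(\<lambda>x. x m) \<circ> (\<lambda>\<omega>. restrict (\<lambda>i. X i \<omega>) {m}) = X m" by auto
  ultimately show ?thesis by simp
qed

lemma measurable_random_sum:
  assumes [measurable]: "V \<in> measurable M (count_space UNIV)"
    and X: "\<And>i. i \<ge> 1 \<Longrightarrow> X i \<in> measurable M (count_space UNIV)"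
  shows "random_sum V X \<in> measurable M (count_space UNIV)"
proof -
  have "(\<lambda>\<omega>. \<Sum>i=1..n. X i \<omega>) \<in> measurable M (count_space UNIV)" for n
    using X by (intro measurable_sum_nat) auto
  then have "(\<lambda>\<omega>. (\<Sum>i=1..V \<omega>. X i \<omega>)) \<in> measurable M (count_space UNIV)"
    by (intro measurable_compose_countable[where g=V and f="\<lambda>n \<omega>. \<Sum>i=1..n. X i \<omega>"]) auto
  then show ?thesis by (simp add: random_sum_def[abs_def])
qed

lemma (in prob_space) prob_index_and_partial_sum:
  assumes "indep_of_seq M V X"
  shows "prob {\<omega> \<in> space M. V \<omega> = n \<and> (\<Sum>i=1..n. X i \<omega>) = k}
    = prob {\<omega> \<in> space M. V \<omega> = n} * prob {\<omega> \<in> space M. (\<Sum>i=1..n. X i \<omega>) = k}"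
proof -
  let ?P = "Pi\<^sub>M {1..} (\<lambda>_. count_space (UNIV :: nat set))"
  define B where "B = {x \<in> space ?P. (\<Sum>i=1..n. x i) = k}"
  have "(\<lambda>x. \<Sum>i=1..n. x i) \<in> measurable ?P (count_space UNIV)" by measurable
  then have B: "B \<in> sets ?P" unfolding B_def by measurable
  have eqB: "{\<omega> \<in> space M. (\<Sum>i=1..n. X i \<omega>) = k} = (\<lambda>\<omega>. \<lambda>i\<in>{1..}. X i \<omega>) -` B \<inter> space M"
    by (auto simp: B_def space_PiM)
  have eqV: "{\<omega> \<in> space M. V \<omega> = n} = V -` {n} \<inter> space M" by auto
  have "prob ({\<omega> \<in> space M. V \<omega> = n} \<inter> {\<omega> \<in> space M. (\<Sum>i=1..n. X i \<omega>) = k})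
    = prob {\<omega> \<in> space M. V \<omega> = n} * prob {\<omega> \<in> space M. (\<Sum>i=1..n. X i \<omega>) = k}"
  proof (rule indep_setD[OF assms[unfolded indep_of_seq_def]])
    show "{\<omega> \<in> space M. V \<omega> = n} \<in> {V -` A \<inter> space M |A. A \<in> sets (count_space UNIV)}"
      unfolding eqV by (intro CollectI exI[of _ "{n}"]) simp
    show "{\<omega> \<in> space M. (\<Sum>i=1..n. X i \<omega>) = k}
        \<in> {(\<lambda>\<omega>. \<lambda>i\<in>{1..}. X i \<omega>) -` B \<inter> space M |B. B \<in> sets ?P}"
      unfolding eqB using B by (intro CollectI exI[of _ B]) simp
  qed
  moreover have "{\<omega> \<in> space M. V \<omega> = n} \<inter> {\<omega> \<in> space M. (\<Sum>i=1..n. X i \<omega>) = k}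
      = {\<omega> \<in> space M. V \<omega> = n \<and> (\<Sum>i=1..n. X i \<omega>) = k}" by auto
  ultimately show ?thesis by simp
qed

lemma (in prob_space) nn_integral_random_sum:
  fixes f :: "nat \<Rightarrow> ennreal"
  assumes V[measurable]: "V \<in> measurable M (count_space UNIV)"
    and X: "\<And>i. i \<ge> 1 \<Longrightarrow> X i \<in> measurable M (count_space UNIV)"
    and ind: "indep_of_seq M V X"
  shows "(\<integral>\<^sup>+ \<omega>. f (random_sum V X \<omega>) \<partial>M)
    = (\<Sum>n. (\<integral>\<^sup>+ \<omega>. f (\<Sum>i=1..n. X i \<omega>) \<partial>M) * emeasure M {\<omega> \<in> space M. V \<omega> = n})"
proof -
  define S where "S n \<omega> = (\<Sum>i=1..n. X i \<omega>)" for n \<omega>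
  have S[measurable]: "S n \<in> measurable M (count_space UNIV)" for n
    unfolding S_def[abs_def] using X by (intro measurable_sum_nat) auto
  let ?I = "\<lambda>n. indicator {\<omega> \<in> space M. V \<omega> = n} :: 'a \<Rightarrow> ennreal"
  have "(\<integral>\<^sup>+ \<omega>. f (random_sum V X \<omega>) \<partial>M) = (\<integral>\<^sup>+ \<omega>. (\<Sum>n. ?I n \<omega> * f (S n \<omega>)) \<partial>M)"
  proof (rule nn_integral_cong)
    fix \<omega> assume "\<omega> \<in> space M"
    then show "f (random_sum V X \<omega>) = (\<Sum>n. ?I n \<omega> * f (S n \<omega>))"
      by (subst suminf_finite[of "{V \<omega>}"]) (auto simp: random_sum_def S_def)
  qed
  also have "\<dots> = (\<Sum>n. \<integral>\<^sup>+ \<omega>. ?I n \<omega> * f (S n \<omega>) \<partial>M)"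
    by (rule nn_integral_suminf) auto
  also have "\<dots> = (\<Sum>n. (\<integral>\<^sup>+ \<omega>. f (S n \<omega>) \<partial>M) * emeasure M {\<omega> \<in> space M. V \<omega> = n})"
  proof (intro suminf_cong)
    fix n
    have "(\<integral>\<^sup>+ \<omega>. ?I n \<omega> * f (S n \<omega>) \<partial>M)
        = (\<integral>\<^sup>+ \<omega>. (\<Sum>k. f k * indicator {\<omega> \<in> space M. V \<omega> = n \<and> S n \<omega> = k} \<omega>) \<partial>M)"
    proof (rule nn_integral_cong)
      fix \<omega> assume "\<omega> \<in> space M"
      then show "?I n \<omega> * f (S n \<omega>)
          = (\<Sum>k. f k * indicator {\<omega> \<in> space M. V \<omega> = n \<and> S n \<omega> = k} \<omega>)"
        by (subst suminf_finite[of "{S n \<omega>}"]) (simp_all add: indicator_def)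
    qed
    also have "\<dots> = (\<Sum>k. f k * emeasure M {\<omega> \<in> space M. V \<omega> = n \<and> S n \<omega> = k})"
      by (subst nn_integral_suminf) (auto simp: nn_integral_cmult_indicator)
    also have "\<dots> = (\<Sum>k. f k * emeasure M {\<omega> \<in> space M. S n \<omega> = k} * emeasure M {\<omega> \<in> space M. V \<omega> = n})"
      unfolding S_def emeasure_eq_measure prob_index_and_partial_sum[OF ind]
      by (simp add: ennreal_mult mult.assoc mult.commute[of "ennreal (prob {\<omega> \<in> space M. V \<omega> = n})"])
    also have "\<dots> = (\<integral>\<^sup>+ \<omega>. f (S n \<omega>) \<partial>M) * emeasure M {\<omega> \<in> space M. V \<omega> = n}"
      by (simp only: nn_integral_nat_valued[OF S] ennreal_suminf_multc)
    finally show "(\<integral>\<^sup>+ \<omega>. ?I n \<omega> * f (S n \<omega>) \<partial>M)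
        = (\<integral>\<^sup>+ \<omega>. f (S n \<omega>) \<partial>M) * emeasure M {\<omega> \<in> space M. V \<omega> = n}" .
  qed
  finally show ?thesis by (simp add: S_def)
qed

lemma (in prob_space) prob_random_sum_ge:
  assumes V[measurable]: "V \<in> measurable M (count_space UNIV)"
    and X: "\<And>i. i \<ge> 1 \<Longrightarrow> X i \<in> measurable M (count_space UNIV)"
    and ind: "indep_of_seq M V X"
  shows "prob {\<omega> \<in> space M. V \<omega> = n} * prob {\<omega> \<in> space M. (\<Sum>i=1..n. X i \<omega>) = k}
    \<le> prob {\<omega> \<in> space M. random_sum V X \<omega> = k}"
proof -
  have [measurable]: "random_sum V X \<in> measurable M (count_space UNIV)"
    using V X by (rule measurable_random_sum)
  show ?thesis
    unfolding prob_index_and_partial_sum[OF ind, symmetric]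
  proof (rule finite_measure_mono)
    show "{\<omega> \<in> space M. random_sum V X \<omega> = k} \<in> events" by measurable
  qed (auto simp: random_sum_def)
qed

text \<open>The four-point inequality is applied with the increments \<open>X\<^sub>n\<^sub>+\<^sub>1\<close> and \<open>X\<^sub>n\<^sub>+\<^sub>2\<close> after the
first \<open>n\<close> terms. The two mixed expectations agree since the increments are interchangeable.\<close>

lemma (in prob_space) partial_sum_expectation_convex:
  fixes X :: "nat \<Rightarrow> 'a \<Rightarrow> nat" and f :: "nat \<Rightarrow> real"
  assumes iid: "iid_seq M X"
    and f: "\<And>n. f n \<ge> 0" "\<And>n. 2 * f (n + 1) \<le> f n + f (n + 2)"
  defines "G \<equiv> \<lambda>n. \<integral>\<^sup>+ \<omega>. ennreal (f (\<Sum>i=1..n. X i \<omega>)) \<partial>M"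
  shows "2 * G (n + 1) \<le> G n + G (n + 2)"
proof -
  note ind = iid_seqD(1)[OF iid] and X = iid_seqD(2)[OF iid] and dist = iid_seqD(3)[OF iid]
  have [measurable]: "X (Suc n) \<in> measurable M (count_space UNIV)"
    "X (Suc (Suc n)) \<in> measurable M (count_space UNIV)" using X by auto
  define S where "S \<omega> = (\<Sum>i=1..n. X i \<omega>)" for \<omega>
  have [measurable]: "S \<in> measurable M (count_space UNIV)"
    unfolding S_def[abs_def] using X by (intro measurable_sum_nat) auto
  have "distr M (count_space UNIV) (X (Suc n)) = distr M (count_space UNIV) (X (Suc (Suc n)))"
    using dist[of "Suc n"] dist[of "Suc (Suc n)"] by (simp only: le_add1 Suc_eq_plus1_left)
  then have swap: "(\<integral>\<^sup>+ \<omega>. ennreal (f (S \<omega> + X (Suc n) \<omega>)) \<partial>M)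
      = (\<integral>\<^sup>+ \<omega>. ennreal (f (S \<omega> + X (Suc (Suc n)) \<omega>)) \<partial>M)"
    unfolding S_def
    by (intro nn_integral_indep_sum_cong[where f="\<lambda>k. ennreal (f k)"] indep_partial_sum[OF ind]) auto
  have "2 * G (n + 1) = (\<integral>\<^sup>+ \<omega>. ennreal (f (S \<omega> + X (Suc n) \<omega>)) \<partial>M)
      + (\<integral>\<^sup>+ \<omega>. ennreal (f (S \<omega> + X (Suc (Suc n)) \<omega>)) \<partial>M)"
    using swap by (simp add: G_def S_def mult_2)
  also have "\<dots> = (\<integral>\<^sup>+ \<omega>. ennreal (f (S \<omega> + X (Suc n) \<omega>)) + ennreal (f (S \<omega> + X (Suc (Suc n)) \<omega>)) \<partial>M)"
    by (rule nn_integral_add[symmetric]) auto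
  also have "\<dots> \<le> (\<integral>\<^sup>+ \<omega>. ennreal (f (S \<omega>)) + ennreal (f (S \<omega> + X (Suc n) \<omega> + X (Suc (Suc n)) \<omega>)) \<partial>M)"
    using f(1) convex_four_point[OF f(2)] by (intro nn_integral_mono) (auto simp flip: ennreal_plus)
  also have "\<dots> = G n + G (n + 2)"
    by (subst nn_integral_add) (simp, simp, simp add: G_def S_def)
  finally show ?thesis .
qed

text \<open>Conditioning on the number of summands reduces the claim to the convex order of \<open>V\<close> and \<open>Z\<close>,
applied to \<open>G n = E f(X\<^sub>1 + \<dots> + X\<^sub>n)\<close>. The convex order is available for real-valued functions
only; this is enough because every value of \<open>G\<close> has positive weight on the right-hand side, so that
an infinite value of \<open>G\<close> makes the right-hand side infinite.\<close>

lemma (in prob_space) nn_integral_random_sum_mono: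
  fixes f :: "nat \<Rightarrow> real" and V Z :: "'a \<Rightarrow> nat"
  assumes V: "V \<in> measurable M (count_space UNIV)" and Z: "Z \<in> measurable M (count_space UNIV)"
    and iid: "iid_seq M X" and iV: "indep_of_seq M V X" and iZ: "indep_of_seq M Z X"
    and f: "\<And>n. f n \<ge> 0" "\<And>n. 2 * f (n + 1) \<le> f n + f (n + 2)"
    and Z_pos: "\<And>n. prob {\<omega> \<in> space M. Z \<omega> = n} > 0"
    and cx: "\<And>g :: nat \<Rightarrow> real. (\<And>n. g n \<ge> 0) \<Longrightarrow> (\<And>n. 2 * g (n + 1) \<le> g n + g (n + 2)) \<Longrightarrow>
      (\<integral>\<^sup>+ \<omega>. ennreal (g (V \<omega>)) \<partial>M) \<le> (\<integral>\<^sup>+ \<omega>. ennreal (g (Z \<omega>)) \<partial>M)"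
  shows "(\<integral>\<^sup>+ \<omega>. ennreal (f (random_sum V X \<omega>)) \<partial>M)
    \<le> (\<integral>\<^sup>+ \<omega>. ennreal (f (random_sum Z X \<omega>)) \<partial>M)"
proof (cases "(\<integral>\<^sup>+ \<omega>. ennreal (f (random_sum Z X \<omega>)) \<partial>M) = \<infinity>")
  case False
  have X: "X i \<in> measurable M (count_space UNIV)" if "i \<ge> 1" for i
    using that by (rule iid_seqD(2)[OF iid])
  define G where "G n = (\<integral>\<^sup>+ \<omega>. ennreal (f (\<Sum>i=1..n. X i \<omega>)) \<partial>M)" for n
  have rs: "(\<integral>\<^sup>+ \<omega>. ennreal (f (random_sum U X \<omega>)) \<partial>M) = (\<integral>\<^sup>+ \<omega>. G (U \<omega>) \<partial>M)"
    if "U \<in> measurable M (count_space UNIV)" "indep_of_seq M U X" for U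
  proof -
    have "(\<integral>\<^sup>+ \<omega>. ennreal (f (random_sum U X \<omega>)) \<partial>M)
        = (\<Sum>n. G n * emeasure M {\<omega> \<in> space M. U \<omega> = n})"
      unfolding G_def
      by (rule nn_integral_random_sum[OF that(1) X that(2), of "\<lambda>n. ennreal (f n)"])
    also have "\<dots> = (\<integral>\<^sup>+ \<omega>. G (U \<omega>) \<partial>M)"
      by (rule nn_integral_nat_valued[OF that(1), symmetric])
    finally show ?thesis .
  qed
  have G_fin: "G n < \<infinity>" for n
  proof (rule ccontr)
    assume "\<not> G n < \<infinity>"
    then have "G n * emeasure M {\<omega> \<in> space M. Z \<omega> = n} = \<infinity>"
      using Z_pos[of n] by (simp add: emeasure_eq_measure ennreal_top_mult less_top[symmetric])
    moreover have "(\<Sum>i\<in>{n}. G i * emeasure M {\<omega> \<in> space M. Z \<omega> = i})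
        \<le> (\<integral>\<^sup>+ \<omega>. G (Z \<omega>) \<partial>M)"
      unfolding nn_integral_nat_valued[OF Z] by (rule sum_le_suminf) auto
    ultimately show False using False rs[OF Z iZ] by (simp add: top_unique)
  qed
  define g where "g n = enn2real (G n)" for n
  have G: "G n = ennreal (g n)" for n using G_fin[of n] by (simp add: g_def)
  have g0: "g n \<ge> 0" for n by (simp add: g_def)
  have "ennreal (2 * g (n + 1)) \<le> ennreal (g n + g (n + 2))" for n
    using partial_sum_expectation_convex[OF iid f, of n] unfolding G_def[symmetric] G
    by (simp add: g0 ennreal_mult')
  then have "2 * g (n + 1) \<le> g n + g (n + 2)" for n
    using g0 by (subst (asm) ennreal_le_iff) (auto intro: add_nonneg_nonneg)
  then show ?thesis unfolding rs[OF V iV] rs[OF Z iZ] G by (intro cx g0)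
qed simp

lemma (in prob_space) prob_partial_sum_multiple_pos:
  fixes X :: "nat \<Rightarrow> 'a \<Rightarrow> nat"
  assumes iid: "iid_seq M X" and pos: "prob {\<omega> \<in> space M. X 1 \<omega> = k} > 0"
  shows "prob {\<omega> \<in> space M. (\<Sum>i=1..n. X i \<omega>) = n * k} > 0"
proof (induction n)
  case 0
  then show ?case by (simp add: prob_space)
next
  case (Suc n)
  note ind = iid_seqD(1)[OF iid] and X = iid_seqD(2)[OF iid]
  have [measurable]: "X (Suc n) \<in> measurable M (count_space UNIV)"
    "X 1 \<in> measurable M (count_space UNIV)" using X by auto
  define S where "S \<omega> = (\<Sum>i=1..n. X i \<omega>)" for \<omega>
  have [measurable]: "S \<in> measurable M (count_space UNIV)"
    unfolding S_def[abs_def] using X by (intro measurable_sum_nat) auto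
  have "0 < prob {\<omega> \<in> space M. S \<omega> = n * k} * prob {\<omega> \<in> space M. X (Suc n) \<omega> = k}"
    using Suc pos iid_seqD(4)[OF iid, of "Suc n" k] by (simp add: S_def)
  also have "\<dots> = prob ((\<lambda>\<omega>. (S \<omega>, X (Suc n) \<omega>)) -` ({n * k} \<times> {k}) \<inter> space M)"
    using indep_varD[OF indep_partial_sum[OF ind, of n "Suc n"], of "{n * k}" "{k}"]
    by (simp add: S_def vimage_def Int_def conj_ac)
  also have "\<dots> \<le> prob {\<omega> \<in> space M. S \<omega> + X (Suc n) \<omega> = Suc n * k}"
    by (rule finite_measure_mono) auto
  finally show ?case by (simp add: S_def)
qed

text \<open>The sum \<open>n * k\<close> is reached by \<open>n\<close> summands all equal to \<open>k\<close>, so the support contains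
arbitrarily large numbers and 0; being an interval, it contains everything.\<close>

lemma (in prob_space) random_sum_full_support:
  assumes V: "V \<in> measurable M (count_space UNIV)" and iid: "iid_seq M X"
    and ind: "indep_of_seq M V X"
    and V_pos: "\<And>n. prob {\<omega> \<in> space M. V \<omega> = n} > 0"
    and k: "k \<ge> 1" "prob {\<omega> \<in> space M. X 1 \<omega> = k} > 0"
    and lc: "log_concave_rv M (random_sum V X)"
  shows "prob {\<omega> \<in> space M. random_sum V X \<omega> = i} > 0"
proof -
  have mult: "n * k \<in> rv_support M (random_sum V X)" for n
  proof -
    have "0 < prob {\<omega> \<in> space M. V \<omega> = n} * prob {\<omega> \<in> space M. (\<Sum>i=1..n. X i \<omega>) = n * k}"
      using V_pos[of n] prob_partial_sum_multiple_pos[OF iid k(2), of n] by (rule mult_pos_pos)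
    also have "\<dots> \<le> prob {\<omega> \<in> space M. random_sum V X \<omega> = n * k}"
      by (rule prob_random_sum_ge[OF V iid_seqD(2)[OF iid] ind])
    finally show ?thesis by (simp add: rv_support_def)
  qed
  have "{0 * k..i * k} \<subseteq> rv_support M (random_sum V X)"
    using lc mult unfolding log_concave_rv_def by blast
  moreover have "i \<in> {0 * k..i * k}" using k(1) by simp
  ultimately show ?thesis unfolding rv_support_def by blast
qed

lemma (in prob_space) random_sum_AE_zero:
  assumes iid: "iid_seq M X" and z: "\<And>k. k \<ge> 1 \<Longrightarrow> prob {\<omega> \<in> space M. X 1 \<omega> = k} = 0"
  shows "AE \<omega> in M. random_sum V X \<omega> = 0"
proof -
  have "AE \<omega> in M. X (Suc i) \<omega> \<noteq> Suc k" for i k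
  proof -
    have [measurable]: "X (Suc i) \<in> measurable M (count_space UNIV)"
      using iid_seqD(2)[OF iid] by simp
    have "prob {\<omega> \<in> space M. X (Suc i) \<omega> = Suc k} = 0"
      using iid_seqD(4)[OF iid, of "Suc i" "Suc k"] z[of "Suc k"] by simp
    then show ?thesis by (subst (asm) prob_Collect_eq_0) auto
  qed
  then have "AE \<omega> in M. \<forall>i k. X (Suc i) \<omega> \<noteq> Suc k" by (simp add: AE_all_countable)
  then show ?thesis
  proof eventually_elim
    case (elim \<omega>)
    have "X i \<omega> = 0" if "i \<ge> 1" for i
      using that elim[rule_format, of "i - 1"] by (cases "X i \<omega>") auto
    then show ?case by (simp add: random_sum_def)
  qed
qed

section \<open>Entropy and cross-entropy\<close>

text \<open>Termwise, \<open>ln x \<le> x - 1\<close> at \<open>x = p i / q i\<close> gives \<open>- q i ln (q i) + q i \<le> - q i ln (p i) + p i\<close>.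
Adding \<open>q i\<close> and \<open>p i\<close>, both of total mass 1, avoids subtracting series that may diverge.\<close>

lemma gibbs_inequality:
  fixes p q :: "nat \<Rightarrow> real"
  assumes p: "\<And>i. p i > 0" "p sums 1" and q: "\<And>i. q i \<ge> 0" "q sums 1"
  shows "(\<Sum>i. ennreal (- (q i * ln (q i)))) \<le> (\<Sum>i. ennreal (- ln (p i)) * ennreal (q i))"
proof -
  have le1: "r i \<le> 1" if "\<And>i. r i \<ge> 0" "r sums 1" for r :: "nat \<Rightarrow> real" and i
    using sum_le_suminf[OF sums_summable[OF that(2)], of "{i}"] that by (auto simp: sums_iff)
  have term_le: "- (q i * ln (q i)) + q i \<le> - ln (p i) * q i + p i" for i
  proof (cases "q i = 0")
    case False
    then have "q i > 0" using q(1)[of i] by simp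
    then have "q i * ln (p i / q i) \<le> q i * (p i / q i - 1)"
      using p(1)[of i] by (intro mult_left_mono ln_le_minus_one) auto
    then show ?thesis using \<open>q i > 0\<close> p(1)[of i] by (simp add: ln_div algebra_simps)
  qed (use p(1)[of i] in simp)
  have q1: "(\<Sum>i. ennreal (q i)) = 1" using q by (simp add: sums_iff suminf_ennreal2)
  have p1: "(\<Sum>i. ennreal (p i)) = 1" using p by (simp add: sums_iff suminf_ennreal2 less_imp_le)
  \<comment> \<open>The embedding into \<open>[0, \<infinity>]\<close> truncates at 0, so the real inequality transfers only with these signs.\<close>
  have lq: "q i * ln (q i) \<le> 0" for i
    using q le1[OF q] by (cases "q i = 0") (auto intro!: mult_nonneg_nonpos simp: order_less_le)
  have lp: "ln (p i) \<le> 0" for i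
    using p(1)[of i] le1[OF less_imp_le[OF p(1)] p(2), of i] by simp
  have term_le': "ennreal (- (q i * ln (q i))) + ennreal (q i)
      \<le> ennreal (- ln (p i)) * ennreal (q i) + ennreal (p i)" for i
  proof -
    have "ennreal (- (q i * ln (q i))) + ennreal (q i) = ennreal (- (q i * ln (q i)) + q i)"
      using lq[of i] q(1)[of i] by (intro ennreal_plus[symmetric]) auto
    also have "\<dots> \<le> ennreal (- ln (p i) * q i + p i)" by (rule ennreal_leI[OF term_le])
    also have "\<dots> = ennreal (- ln (p i) * q i) + ennreal (p i)"
      using lp[of i] q(1)[of i] p(1)[of i]
      by (intro ennreal_plus mult_nonneg_nonneg) auto
    also have "ennreal (- ln (p i) * q i) = ennreal (- ln (p i)) * ennreal (q i)"
      using lp[of i] q(1)[of i] by (intro ennreal_mult) auto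
    finally show ?thesis .
  qed
  have "(\<Sum>i. ennreal (- (q i * ln (q i)))) + 1
      = (\<Sum>i. ennreal (- (q i * ln (q i))) + ennreal (q i))"
    by (simp add: suminf_add[symmetric] q1)
  also have "\<dots> \<le> (\<Sum>i. ennreal (- ln (p i)) * ennreal (q i) + ennreal (p i))"
    by (intro suminf_le term_le') auto
  also have "\<dots> = (\<Sum>i. ennreal (- ln (p i)) * ennreal (q i)) + 1"
    by (simp add: suminf_add[symmetric] p1)
  finally show ?thesis by (simp add: ennreal_add_left_cancel_le add.commute[of _ 1])
qed

lemma (in prob_space) nat_valued_sums_1:
  assumes V[measurable]: "V \<in> measurable M (count_space (UNIV :: nat set))"
  shows "(\<lambda>i. prob {\<omega> \<in> space M. V \<omega> = i}) sums 1"
proof -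
  have "(\<lambda>i. prob {\<omega> \<in> space M. V \<omega> = i}) sums prob (\<Union>i. {\<omega> \<in> space M. V \<omega> = i})"
    by (rule finite_measure_UNION) (auto simp: disjoint_family_on_def)
  moreover have "(\<Union>i. {\<omega> \<in> space M. V \<omega> = i}) = space M" by auto
  ultimately show ?thesis by (simp add: prob_space)
qed

lemma (in prob_space) shannon_entropy_le_cross_entropy:
  fixes p :: "nat \<Rightarrow> real"
  assumes V: "V \<in> measurable M (count_space UNIV)" and p: "\<And>i. p i > 0" "p sums 1"
  shows "shannon_entropy M V \<le> (\<integral>\<^sup>+ \<omega>. ennreal (- ln (p (V \<omega>))) \<partial>M)"
proof -
  have "shannon_entropy M V
      \<le> (\<Sum>i. ennreal (- ln (p i)) * ennreal (prob {\<omega> \<in> space M. V \<omega> = i}))"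
    unfolding shannon_entropy_def
    by (rule gibbs_inequality[OF p measure_nonneg nat_valued_sums_1[OF V]])
  also have "\<dots> = (\<integral>\<^sup>+ \<omega>. ennreal (- ln (p (V \<omega>))) \<partial>M)"
    unfolding nn_integral_nat_valued[OF V, of "\<lambda>i. ennreal (- ln (p i))"] emeasure_eq_measure ..
  finally show ?thesis .
qed

lemma (in prob_space) shannon_entropy_eq_nn_integral:
  assumes V: "V \<in> measurable M (count_space UNIV)"
  shows "shannon_entropy M V
    = (\<integral>\<^sup>+ \<omega>. ennreal (- ln (prob {\<omega>' \<in> space M. V \<omega>' = V \<omega>})) \<partial>M)"
proof -
  have "ennreal (- (p * ln p)) = ennreal (- ln p) * ennreal p" if "p \<ge> 0" "p \<le> 1" for p :: real
    using that by (cases "p = 0") (simp_all add: mult.commute flip: ennreal_mult)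
  then show ?thesis
    unfolding nn_integral_nat_valued[OF V, of "\<lambda>i. ennreal (- ln (prob {\<omega> \<in> space M. V \<omega> = i}))"]
      shannon_entropy_def emeasure_eq_measure by simp
qed

lemma (in prob_space) shannon_entropy_AE_zero:
  assumes V[measurable]: "V \<in> measurable M (count_space UNIV)" and z: "AE \<omega> in M. V \<omega> = 0"
  shows "shannon_entropy M V = 0"
proof -
  have "prob {\<omega> \<in> space M. V \<omega> = i} = (if i = 0 then 1 else 0)" for i
  proof (cases "i = 0")
    case True
    then show ?thesis using z by (simp add: prob_Collect_eq_1)
  next
    case False
    with z have "AE \<omega> in M. V \<omega> \<noteq> i" by (auto elim: eventually_mono)
    then show ?thesis using False by (simp add: prob_Collect_eq_0)
  qed
  then have "ennreal (- (prob {\<omega> \<in> space M. V \<omega> = i} * ln (prob {\<omega> \<in> space M. V \<omega> = i}))) = 0" for i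
    by simp
  then show ?thesis unfolding shannon_entropy_def by (simp only: suminf_zero)
qed

section \<open>Entropy comparison with compound Poisson sums\<close>

theorem corollary2p4:
  fixes M :: "'a measure" and N :: "'b measure"
    and W Z :: "'a \<Rightarrow> nat" and Ws :: "'b \<Rightarrow> nat"
    and X :: "nat \<Rightarrow> 'a \<Rightarrow> nat" and l :: real
  assumes "prob_space M" and "prob_space N"
    and "W \<in> measurable M (count_space UNIV)"
    and "integrable M (\<lambda>\<omega>. real (W \<omega>))"
    and "integral\<^sup>L M (\<lambda>\<omega>. real (W \<omega>)) = l" and "l > 0"
    and "Ws \<in> measurable N (count_space UNIV)"
    and "size_biased M W N Ws"
    and "stoch_ge M (\<lambda>\<omega>. W \<omega> + 1) N Ws"
    and "Z \<in> measurable M (count_space UNIV)"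
    and "distr M (count_space UNIV) Z = measure_pmf (poisson_pmf l)"
    and "iid_seq M X"
    and "indep_of_seq M W X"
    and "indep_of_seq M Z X"
    and "log_concave_rv M (random_sum Z X)"
  shows "shannon_entropy M (random_sum W X) \<le> shannon_entropy M (random_sum Z X)"
proof -
  interpret prob_space M by fact
  note W = assms(3-5) and Z = assms(10) and iid = assms(12) and lc = assms(15)
  note poisson = poisson_size_biased[OF \<open>l > 0\<close> Z assms(11)]
  have X: "X i \<in> measurable M (count_space UNIV)" if "i \<ge> 1" for i
    using that by (rule iid_seqD(2)[OF iid])
  have mW: "random_sum W X \<in> measurable M (count_space UNIV)"
    by (rule measurable_random_sum[OF W(1) X])
  have mZ: "random_sum Z X \<in> measurable M (count_space UNIV)"
    by (rule measurable_random_sum[OF Z X])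
  show ?thesis
  proof (cases "\<exists>k\<ge>1. prob {\<omega> \<in> space M. X 1 \<omega> = k} > 0")
    case False
    then have "prob {\<omega> \<in> space M. X 1 \<omega> = k} = 0" if "k \<ge> 1" for k
      using that measure_nonneg[of M "{\<omega> \<in> space M. X 1 \<omega> = k}"] by (metis less_eq_real_def)
    then show ?thesis
      using shannon_entropy_AE_zero[OF mW random_sum_AE_zero[OF iid]] by simp
  next
    case True
    then obtain k where k: "k \<ge> 1" "prob {\<omega> \<in> space M. X 1 \<omega> = k} > 0" by blast
    define p where "p i = prob {\<omega> \<in> space M. random_sum Z X \<omega> = i}" for i
    have Z_pos: "prob {\<omega> \<in> space M. Z \<omega> = n} > 0" for n
      using \<open>l > 0\<close> by (simp add: poisson(1))
    have p_pos: "p i > 0" for i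
      unfolding p_def by (rule random_sum_full_support[OF Z iid assms(14) Z_pos k lc])
    have f0: "- ln (p i) \<ge> 0" for i using p_pos[of i] by (simp add: p_def)
    have fcx: "2 * - ln (p (n + 1)) \<le> - ln (p n) + - ln (p (n + 2))" for n
    proof -
      have "p n * p (n + 2) \<le> (p (n + 1))\<^sup>2"
        using conjunct2[OF lc[unfolded log_concave_rv_def], rule_format, of "n + 1"]
        by (simp add: p_def)
      then have "ln (p n * p (n + 2)) \<le> ln ((p (n + 1))\<^sup>2)"
        using p_pos by (intro ln_mono) auto
      then show ?thesis using p_pos by (simp add: ln_mult ln_realpow less_imp_neq[symmetric])
    qed
    have "shannon_entropy M (random_sum W X) \<le> (\<integral>\<^sup>+ \<omega>. ennreal (- ln (p (random_sum W X \<omega>))) \<partial>M)"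
      using p_pos nat_valued_sums_1[OF mZ]
      by (intro shannon_entropy_le_cross_entropy[OF mW]) (simp_all add: p_def)
    also have "\<dots> \<le> (\<integral>\<^sup>+ \<omega>. ennreal (- ln (p (random_sum Z X \<omega>))) \<partial>M)"
    proof (rule nn_integral_random_sum_mono[OF W(1) Z iid assms(13,14) f0 fcx Z_pos])
      fix g :: "nat \<Rightarrow> real"
      assume g: "\<And>n. g n \<ge> 0" "\<And>n. 2 * g (n + 1) \<le> g n + g (n + 2)"
      show "(\<integral>\<^sup>+ \<omega>. ennreal (g (W \<omega>)) \<partial>M) \<le> (\<integral>\<^sup>+ \<omega>. ennreal (g (Z \<omega>)) \<partial>M)"
        using W poisson(3) g
        by (intro stop_loss_order_imp_convex_order[OF W(1,2) Z poisson(2)]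
            stop_loss_le[OF \<open>prob_space N\<close> \<open>l > 0\<close> W assms(7-9) Z poisson(2-4)]) simp_all
    qed
    also have "\<dots> = shannon_entropy M (random_sum Z X)"
      unfolding p_def by (rule shannon_entropy_eq_nn_integral[OF mZ, symmetric])
    finally show ?thesis .
  qed
qed

end
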